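(* Let $U$ be a non-empty closed qset. For all $A, B \in \mathcal{P}(U)$: if $A \leq B$, then $A \sqcup (A \sqcup B^{\bot})^{\bot} = \overline{B}$.
   Context: The setting is quasi-set theory, an extension of Zermelo–Fraenkel set theory with Urelemente in which a quasi-set (qset) may contain objects ($m$-atoms) to which identity does not apply. There is a primitive indistinguishability relation $\equiv$ on objects, which is reflexive, symmetric and transitive; $x \equiv y$ does not imply that $x$ and $y$ are the same object, nor that they belong to the same qsets. Membership, subqset $\subseteq$, $\cup$, $\cap$, difference $-$ and the power qset $\mathcal{P}(U)$ (all subqsets of $U$) work as in usual set theory. The symbol $=$ between qsets is extensional equality: two qsets are equal iff they have the same elements. $U$ is a fixed non-empty qset (the universe), assumed closed, i.e. it contains all objects indistinguishable from its elements. For $A \subseteq U$, the cloud of $A$ is $\overline{A} = [\,y \in U : \exists x\,(x \in A \wedge y \equiv x)\,]$. Define $A \sqcup B = \overline{A} \cup \overline{B}$; $A \leq B$ iff $A \sqcup B = \overline{B}$; and $A^{\bot} = U - \overline{A}$. *)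

theory Defs
  imports Main
begin

text \<open>
  Objects (m-atoms included) are the elements of an arbitrary type \<open>'a\<close>, and the primitive
  indistinguishability relation on them is a parameter \<open>ind\<close>, assumed to be an equivalence
  relation and nothing more: \<open>ind x y\<close> neither implies that \<open>x\<close> and \<open>y\<close> are the same object
  nor that they belong to the same qsets.  Qsets are values of type \<open>'a set\<close>, whose
  equality is extensional equality.  HOL provides equality on every type, but the definitions
  below never compare objects of type \<open>'a\<close> by it, only by \<open>ind\<close>.
\<close>

definition closed_qset :: "('a \<Rightarrow> 'a \<Rightarrow> bool) \<Rightarrow> 'a set \<Rightarrow> bool" where
  "closed_qset ind U \<longleftrightarrow> (\<forall>x\<in>U. \<forall>y. ind y x \<longrightarrow> y \<in> U)"

definition cloud :: "('a \<Rightarrow> 'a \<Rightarrow> bool) \<Rightarrow> 'a set \<Rightarrow> 'a set \<Rightarrow> 'a set" where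
  "cloud ind U A = {y \<in> U. \<exists>x. x \<in> A \<and> ind y x}"

definition qjoin :: "('a \<Rightarrow> 'a \<Rightarrow> bool) \<Rightarrow> 'a set \<Rightarrow> 'a set \<Rightarrow> 'a set \<Rightarrow> 'a set" where
  "qjoin ind U A B = cloud ind U A \<union> cloud ind U B"

definition qle :: "('a \<Rightarrow> 'a \<Rightarrow> bool) \<Rightarrow> 'a set \<Rightarrow> 'a set \<Rightarrow> 'a set \<Rightarrow> bool" where
  "qle ind U A B \<longleftrightarrow> qjoin ind U A B = cloud ind U B"

definition qperp :: "('a \<Rightarrow> 'a \<Rightarrow> bool) \<Rightarrow> 'a set \<Rightarrow> 'a set \<Rightarrow> 'a set" where
  "qperp ind U A = U - cloud ind U A"

end

theory Submission
  imports Defs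
begin

text \<open>
  Clouds are exactly the subqsets of \<open>U\<close> that are saturated under indistinguishability, and
  these form a Boolean algebra of subqsets of \<open>U\<close>. On saturated qsets the operations reduce
  to union and complement, and the claim becomes the orthomodular law of that algebra.
\<close>

lemma cloud_subset: "cloud ind U A \<subseteq> U"
  by (auto simp: cloud_def)

lemma cloud_cloud:
  assumes "equivp ind"
  shows "cloud ind U (cloud ind U A) = cloud ind U A"
  using equivp_reflp[OF assms] equivp_transp[OF assms] unfolding cloud_def by blast

lemma cloud_Un: "cloud ind U (A \<union> B) = cloud ind U A \<union> cloud ind U B"
  by (auto simp: cloud_def)

text \<open>If \<open>x\<close> lies outside the cloud of \<open>A\<close> and
  \<open>ind y x\<close>, then \<open>y\<close> lies outside it too: by symmetry and transitivity,
  an element of \<open>A\<close> indistinguishable from \<open>y\<close> would be so from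
  \<open>x\<close>.\<close>

lemma cloud_qperp:
  assumes "equivp ind"
  shows "cloud ind U (qperp ind U A) = qperp ind U A"
  using equivp_reflp[OF assms] equivp_symp[OF assms] equivp_transp[OF assms]
  unfolding qperp_def cloud_def by blast

lemma cloud_qjoin:
  assumes "equivp ind"
  shows "cloud ind U (qjoin ind U A B) = qjoin ind U A B"
  by (simp add: qjoin_def cloud_Un cloud_cloud[OF assms])

theorem theorem3p11:
  fixes ind :: "'a \<Rightarrow> 'a \<Rightarrow> bool" and U A B :: "'a set"
  assumes "equivp ind"
    and "U \<noteq> {}"
    and "closed_qset ind U"
    and "A \<in> Pow U"
    and "B \<in> Pow U"
    and "qle ind U A B"
  shows "qjoin ind U A (qperp ind U (qjoin ind U A (qperp ind U B))) = cloud ind U B"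
proof -
  let ?a = "cloud ind U A" and ?b = "cloud ind U B"
  have "?a \<subseteq> ?b"
    using assms(6) unfolding qle_def qjoin_def by blast
  have "qjoin ind U A (qperp ind U B) = ?a \<union> (U - ?b)"
    by (simp add: qjoin_def cloud_qperp[OF assms(1)]) (simp add: qperp_def)
  \<comment> \<open>The join is already saturated, so the cloud taken inside the outer
    \<open>qperp\<close> changes nothing.\<close>
  then have "qperp ind U (qjoin ind U A (qperp ind U B)) = U - (?a \<union> (U - ?b))"
    using cloud_qjoin[OF assms(1)] by (metis qperp_def)
  then have "qjoin ind U A (qperp ind U (qjoin ind U A (qperp ind U B)))
      = ?a \<union> (U - (?a \<union> (U - ?b)))"
    using cloud_qperp[OF assms(1)] by (metis qjoin_def)
  \<comment> \<open>As \<open>?b\<close> lies in \<open>U\<close>, the complement is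
    \<open>?b - ?a\<close>; adding \<open>?a\<close> back gives \<open>?b\<close> because
    \<open>?a\<close> lies in \<open>?b\<close>.\<close>
  also have "\<dots> = ?b"
    using \<open>?a \<subseteq> ?b\<close> cloud_subset[of ind U B] by blast
  finally show ?thesis .
qed

end
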